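(* Let $\varphi$ be a rotation angle that is an irrational multiple of $2\pi$, and let $\theta\in(0,\frac{\pi}{4})$. Define the unary promise problem $\mathtt{L^\theta}=(\mathtt{L^\theta_{yes}},\mathtt{L^\theta_{no}})$ by $\mathtt{L^\theta_{yes}}=\{a^k\mid k\varphi\in[l\pi-\theta,l\pi+\theta]\text{ for some integer }l\ge 0\}$ and $\mathtt{L^\theta_{no}}=\{a^k\mid k\varphi\in[l\pi+\frac{\pi}{2}-\theta,l\pi+\frac{\pi}{2}+\theta]\text{ for some integer }l\ge0\}$. Then there is a $2$-state Moore–Crutchfield QFA, all of whose transition amplitudes are real numbers, that solves $\mathtt{L^\theta}$ with error bound $\sin^2\theta<\frac12$.
   Context: A Moore–Crutchfield QFA is $(Q,\Sigma,\{U_\sigma\}_{\sigma\in\Sigma},|v_0\rangle,Q_a)$ with finite state set $Q$, unitary matrices $U_\sigma$, unit-norm complex initial vector $|v_0\rangle$ and accepting set $Q_a$; on input $w=w_1\cdots w_\ell$ the final vector is $|v_\ell\rangle=U_{w_\ell}\cdots U_{w_1}|v_0\rangle$ and the acceptance probability is $\sum_{q_j\in Q_a}|\,|v_\ell\rangle(j)|^2$. It solves a promise problem $(\mathtt{P_{yes}},\mathtt{P_{no}})$ with error bound $\epsilon<\frac12$ if every yes-instance is accepted with probability at least $1-\epsilon$ and every no-instance is rejected with probability at least $1-\epsilon$. *)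

theory Defs
  imports "HOL-Analysis.Analysis"
begin

definition cadjoint :: "complex ^ 'n ^ 'm \<Rightarrow> complex ^ 'm ^ 'n" where
  "cadjoint A = (\<chi> i j. cnj (A $ j $ i))"

definition unitary_matrix :: "complex ^ 'n ^ 'n \<Rightarrow> bool" where
  "unitary_matrix U \<longleftrightarrow> cadjoint U ** U = mat 1 \<and> U ** cadjoint U = mat 1"

(* Moore-Crutchfield QFA: the input alphabet is the type 's and the finite state set is
   the type 'q, so the number of states is CARD('q). There are no end-markers. *)
record ('s, 'q) mcqfa =
  trans_mat :: "'s \<Rightarrow> complex ^ 'q::finite ^ 'q"
  init_vec :: "complex ^ 'q"
  acc_states :: "'q set"

(* norm on complex ^ 'q is the l2-norm *)
definition is_mcqfa :: "('s, 'q::finite) mcqfa \<Rightarrow> bool" where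
  "is_mcqfa M \<longleftrightarrow> (\<forall>\<sigma>. unitary_matrix (trans_mat M \<sigma>)) \<and> norm (init_vec M) = 1"

definition final_vec :: "('s, 'q::finite) mcqfa \<Rightarrow> 's list \<Rightarrow> complex ^ 'q" where
  "final_vec M w = foldl (\<lambda>v \<sigma>. trans_mat M \<sigma> *v v) (init_vec M) w"

definition accept_prob :: "('s, 'q::finite) mcqfa \<Rightarrow> 's list \<Rightarrow> real" where
  "accept_prob M w = (\<Sum>q\<in>acc_states M. (cmod (final_vec M w $ q))\<^sup>2)"

definition reject_prob :: "('s, 'q::finite) mcqfa \<Rightarrow> 's list \<Rightarrow> real" where
  "reject_prob M w = 1 - accept_prob M w"

definition real_transitions :: "('s, 'q::finite) mcqfa \<Rightarrow> bool" where
  "real_transitions M \<longleftrightarrow> (\<forall>\<sigma> i j. trans_mat M \<sigma> $ i $ j \<in> \<real>)"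

(* the pair consists of the yes-instances and the no-instances *)
type_synonym 's promise_problem = "'s list set \<times> 's list set"

definition solves_with_error ::
  "('s, 'q::finite) mcqfa \<Rightarrow> 's promise_problem \<Rightarrow> real \<Rightarrow> bool" where
  "solves_with_error M P \<epsilon> \<longleftrightarrow> \<epsilon> < 1 / 2 \<and>
     (\<forall>w\<in>fst P. accept_prob M w \<ge> 1 - \<epsilon>) \<and>
     (\<forall>w\<in>snd P. reject_prob M w \<ge> 1 - \<epsilon>)"

datatype unary = Letter_a

definition L_yes :: "real \<Rightarrow> real \<Rightarrow> unary list set" where
  "L_yes \<phi> \<theta> = {replicate k Letter_a | k.
     \<exists>l::nat. real k * \<phi> \<in> {real l * pi - \<theta> .. real l * pi + \<theta>}}"

definition L_no :: "real \<Rightarrow> real \<Rightarrow> unary list set" where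
  "L_no \<phi> \<theta> = {replicate k Letter_a | k.
     \<exists>l::nat. real k * \<phi> \<in> {real l * pi + pi / 2 - \<theta> .. real l * pi + pi / 2 + \<theta>}}"

definition L_problem :: "real \<Rightarrow> real \<Rightarrow> unary promise_problem" where
  "L_problem \<phi> \<theta> = (L_yes \<phi> \<theta>, L_no \<phi> \<theta>)"

end

theory Submission
  imports Defs
begin

text \<open>Take the rotation of the real plane by \<open>\<phi>\<close>, started in the first basis state, which is also
  the only accepting one: after \<open>k\<close> letters the word is accepted with probability
  \<open>(cos (k \<phi>))\<^sup>2\<close>. This function of \<open>k \<phi>\<close> has period \<open>\<pi>\<close>, and a shift by \<open>\<pi>/2\<close>
  exchanges it with \<open>(sin (k \<phi>))\<^sup>2\<close>, so only \<open>(sin d)\<^sup>2 \<le> (sin \<theta>)\<^sup>2\<close> for offsets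
  \<open>\<bar>d\<bar> \<le> \<theta>\<close> is needed.\<close>

text \<open>Each entry is the image of a real number, so realness of the amplitudes can be read
  off.\<close>

definition rotation_matrix :: "real \<Rightarrow> complex ^ 2 ^ 2" where
  "rotation_matrix \<phi> = (\<chi> i j. complex_of_real
     (if i = j then cos \<phi> else if i = 1 then - sin \<phi> else sin \<phi>))"

definition rotation_qfa :: "real \<Rightarrow> (unary, 2) mcqfa" where
  "rotation_qfa \<phi> = \<lparr>trans_mat = (\<lambda>_. rotation_matrix \<phi>), init_vec = axis 1 1, acc_states = {1}\<rparr>"

lemma unitary_rotation_matrix: "unitary_matrix (rotation_matrix \<phi>)"
proof -
  have "complex_of_real (cos \<phi>) * complex_of_real (cos \<phi>)
      + complex_of_real (sin \<phi>) * complex_of_real (sin \<phi>) = 1"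
    by (simp flip: of_real_mult of_real_add add: sin_cos_squared_add3)
  then show ?thesis
    by (simp add: unitary_matrix_def cadjoint_def rotation_matrix_def matrix_matrix_mult_def
        mat_def vec_eq_iff forall_2 sum_2 algebra_simps)
qed

lemma is_mcqfa_rotation_qfa: "is_mcqfa (rotation_qfa \<phi>)"
  by (simp add: is_mcqfa_def rotation_qfa_def unitary_rotation_matrix norm_vec_def L2_set_def
      sum_2 axis_def)

lemma real_transitions_rotation_qfa: "real_transitions (rotation_qfa \<phi>)"
  by (simp add: real_transitions_def rotation_qfa_def rotation_matrix_def)

lemma final_vec_rotation_qfa:
  "final_vec (rotation_qfa \<phi>) (replicate k Letter_a) =
     (\<chi> i. complex_of_real (if i = 1 then cos (real k * \<phi>) else sin (real k * \<phi>)))"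
proof (induction k)
  case 0
  then show ?case
    by (simp add: final_vec_def rotation_qfa_def vec_eq_iff forall_2 axis_def)
next
  case (Suc k)
  have "final_vec (rotation_qfa \<phi>) (replicate (Suc k) Letter_a)
      = rotation_matrix \<phi> *v final_vec (rotation_qfa \<phi>) (replicate k Letter_a)"
    \<comment> \<open>\<open>foldl\<close> applies the matrix of the last letter outermost, so the
      extra letter is moved to the end of the word.\<close>
    unfolding replicate_Suc replicate_append_same[symmetric]
    by (simp add: final_vec_def rotation_qfa_def)
  moreover have "real (Suc k) * \<phi> = \<phi> + real k * \<phi>"
    by (simp add: algebra_simps)
  ultimately show ?case
    unfolding Suc.IH
    by (simp add: vec_eq_iff forall_2 matrix_vector_mult_def rotation_matrix_def sum_2
        cos_add sin_add del: of_nat_Suc)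
qed

lemma accept_prob_rotation_qfa:
  "accept_prob (rotation_qfa \<phi>) (replicate k Letter_a) = (cos (real k * \<phi>))\<^sup>2"
  unfolding accept_prob_def final_vec_rotation_qfa
  by (simp add: rotation_qfa_def)

text \<open>The square of sine is even, and on [0, pi/2] sine is nonnegative and increasing.\<close>

lemma sin_squared_mono:
  fixes d \<theta> :: real
  assumes "\<bar>d\<bar> \<le> \<theta>" and "\<theta> \<le> pi / 2"
  shows "(sin d)\<^sup>2 \<le> (sin \<theta>)\<^sup>2"
proof -
  have "0 \<le> sin \<bar>d\<bar>"
    using assms by (intro sin_ge_zero) auto
  moreover have "sin \<bar>d\<bar> \<le> sin \<theta>"
    using assms by (intro sin_monotone_2pi_le) auto
  ultimately have "(sin \<bar>d\<bar>)\<^sup>2 \<le> (sin \<theta>)\<^sup>2"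
    by (rule power_mono[rotated])
  then show ?thesis
    by (auto simp: abs_if split: if_splits)
qed

text \<open>By the addition formula the shift only multiplies sine by (-1)^l, which squaring
  removes.\<close>

lemma sin_squared_add_multiple_pi: "(sin (real l * pi + d))\<^sup>2 = (sin d)\<^sup>2"
  by (simp add: sin_add power_mult_distrib flip: power_mult)

theorem theorem4:
  fixes \<phi> \<theta> :: real
  assumes "\<phi> / (2 * pi) \<notin> \<rat>"
    and "0 < \<theta>" and "\<theta> < pi / 4"
  shows "(sin \<theta>)\<^sup>2 < 1 / 2 \<and>
    (\<exists>M :: (unary, 2) mcqfa. is_mcqfa M \<and> real_transitions M \<and>
       solves_with_error M (L_problem \<phi> \<theta>) ((sin \<theta>)\<^sup>2))"
proof -
  \<comment> \<open>Since cos (2 \<theta>) = 1 - 2 (sin \<theta>)^2, positivity for 2 \<theta> <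
    pi/2 is exactly the error bound.\<close>
  have "0 < cos (2 * \<theta>)"
    using assms by (intro cos_gt_zero) auto
  then have bound: "(sin \<theta>)\<^sup>2 < 1 / 2"
    by (simp add: cos_double_sin)
  have near: "(sin x)\<^sup>2 \<le> (sin \<theta>)\<^sup>2"
    if "x \<in> {real l * pi - \<theta> .. real l * pi + \<theta>}" for x l
    using that assms sin_squared_mono[of "x - real l * pi" \<theta>]
      sin_squared_add_multiple_pi[of l "x - real l * pi"] by auto
  have "accept_prob (rotation_qfa \<phi>) w \<ge> 1 - (sin \<theta>)\<^sup>2" if "w \<in> L_yes \<phi> \<theta>" for w
    using that near by (auto simp: L_yes_def accept_prob_rotation_qfa cos_squared_eq)
  moreover have "reject_prob (rotation_qfa \<phi>) w \<ge> 1 - (sin \<theta>)\<^sup>2" if no: "w \<in> L_no \<phi> \<theta>" for w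
  proof -
    obtain k and l :: nat where w: "w = replicate k Letter_a"
      and "real k * \<phi> \<in> {real l * pi + pi / 2 - \<theta> .. real l * pi + pi / 2 + \<theta>}"
      using no unfolding L_no_def by blast
    \<comment> \<open>Shifting by pi/2 makes \<open>near\<close> applicable to no-instances too; as
      sin (x - pi/2) = - cos x, it then bounds the acceptance probability.\<close>
    then have "real k * \<phi> - pi / 2 \<in> {real l * pi - \<theta> .. real l * pi + \<theta>}"
      by auto
    then have "(sin (real k * \<phi> - pi / 2))\<^sup>2 \<le> (sin \<theta>)\<^sup>2"
      using near by blast
    then show ?thesis
      by (simp add: w reject_prob_def accept_prob_rotation_qfa sin_diff)
  qed
  ultimately have "solves_with_error (rotation_qfa \<phi>) (L_problem \<phi> \<theta>) ((sin \<theta>)\<^sup>2)"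
    using bound by (simp add: solves_with_error_def L_problem_def)
  then show ?thesis
    using bound is_mcqfa_rotation_qfa real_transitions_rotation_qfa by blast
qed

end
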